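(* Let $m,n,h\in\mathbb{N}$ with $0\le h\le\min\{m,n\}$. The EPOSIC channel $\Phi_{m,n,h}$ is not entanglement breaking whenever $m>n$. In particular, $\Phi_{m,h,h}$ is not entanglement breaking for any $0\le h<m$.
   Context: Conventions: $\mathbb{N}=\{0,1,2,\dots\}$; all vector spaces are finite dimensional and complex. A state of a Hilbert space $H$ is a positive operator in $End(H)$ of trace one; $D(H)$ is the set of states. A quantum channel $\Phi:End(H)\to End(K)$ is a completely positive trace preserving linear map; operators $T_j:H\to K$ are Kraus operators of $\Phi$ if $\sum_jT_j^*T_j=I_H$ and $\Phi(A)=\sum_jT_jAT_j^*$ for all $A$. Entanglement breaking: a state in $D(H_1\otimes H_2)$ is separable if it is a convex combination of states $\sigma\otimes\tau$ with $\sigma\in D(H_1)$, $\tau\in D(H_2)$. A quantum channel $\Phi:End(H)\to End(K)$ is entanglement breaking (E.B.T) if $(\Phi\otimes I_k)(\varrho)$ is separable for every $k\ge1$ and every $\varrho\in D(H\otimes\mathbb{C}^k)$, where $I_k$ is the identity map on $End(\mathbb{C}^k)$. EPOSIC channels: for $k\in\mathbb{N}$, $P_k$ is the $(k+1)$-dimensional space of homogeneous complex polynomials of degree $k$ in $x_1,x_2$, with inner product $\langle x_1^lx_2^{k-l},x_1^{l'}x_2^{k-l'}\rangle=l!(k-l)!\,\delta_{ll'}$ and orthonormal basis $f_l^k=\frac{1}{\sqrt{l!(k-l)!}}x_1^lx_2^{k-l}$, $0\le l\le k$. Let $m,n,h\in\mathbb{N}$ with $0\le h\le\min\{m,n\}$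 and $r=m+n-2h$. For $0\le i\le r$ put $B(i)=\{j\in\mathbb{Z}:\max\{0,-m+i+h\}\le j\le\min\{i+h,n\}\}$, and for $j\in B(i)$ put $l_{ij}=i-j+h$ and $$\varepsilon_i^j=\varepsilon_i^j(m,n,h)=\sum_{s=\max\{0,j-i,j+h-n\}}^{\min\{h,j,j+m-i-h\}}(-1)^s\sqrt{\frac{c_{m,n,h}\,r!\,m!\,n!}{\binom{r}{i}\binom{m}{i-j+h}\binom{n}{j}}}\;\frac{\binom{h}{s}\binom{n-h}{j-s}\binom{m-h}{i-j+s}}{(m-h)!},$$ where $c_{m,n,h}>0$ is the normalization constant for which $\sum_{j\in B(i)}(\varepsilon_i^j)^2=1$ for all $0\le i\le r$; explicitly $c_{m,n,h}=\frac{(m-h)!\,(r+1)}{h!\,(n-h)!\,(m+n-h+1)!}$. For $0\le j\le n$ define $T_j:P_r\to P_m$ linearly by $T_j(f_i^r)=\varepsilon_i^jf_{l_{ij}}^m$ if $j\in B(i)$ and $T_j(f_i^r)=0$ otherwise. The operators $T_0,\dots,T_n$ are Kraus operators (the EPOSIC Kraus operators) of a quantum channel $\Phi_{m,n,h}:End(P_r)\to End(P_m)$, $\Phi_{m,n,h}(A)=\sum_{j=0}^nT_jAT_j^*$, called the EPOSIC channel. *)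

theory Defs
  imports "Jordan_Normal_Form.Schur_Decomposition"
begin

text \<open>
  A Hilbert space of dimension \<open>d\<close> with a chosen orthonormal basis indexed by \<open>0..<d\<close> is
  \<open>carrier_vec d\<close>, and its operators are \<open>carrier_mat d d\<close>. The order on \<^typ>\<open>complex\<close> is that of
  \<^theory>\<open>HOL-Library.Complex_Order\<close>: \<open>0 \<le> z\<close> says that \<open>z\<close> is real and nonnegative.
\<close>

definition positive_op :: "nat \<Rightarrow> complex mat \<Rightarrow> bool" where
  "positive_op d A \<longleftrightarrow>
     A \<in> carrier_mat d d \<and> (\<forall>v \<in> carrier_vec d. 0 \<le> (A *\<^sub>v v) \<bullet>c v)"

definition states :: "nat \<Rightarrow> complex mat set" where
  "states d = {\<rho>. positive_op d \<rho> \<and> (\<Sum>i<d. \<rho> $$ (i, i)) = 1}"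

definition mat_sum :: "nat \<Rightarrow> nat \<Rightarrow> ('i \<Rightarrow> complex mat) \<Rightarrow> 'i set \<Rightarrow> complex mat" where
  "mat_sum nr nc F S = mat nr nc (\<lambda>ij. \<Sum>t\<in>S. F t $$ ij)"

text \<open>
  The tensor product of spaces of dimensions \<open>d\<close> and \<open>k\<close> has dimension \<open>d * k\<close>; the product of
  the basis vectors \<open>i < d\<close> and \<open>a < k\<close> gets index \<open>i * k + a\<close>.
\<close>

definition kron :: "complex mat \<Rightarrow> complex mat \<Rightarrow> complex mat" where
  "kron A B = mat (dim_row A * dim_row B) (dim_col A * dim_col B)
     (\<lambda>(i, j). A $$ (i div dim_row B, j div dim_col B) * B $$ (i mod dim_row B, j mod dim_col B))"

definition separable :: "nat \<Rightarrow> nat \<Rightarrow> complex mat \<Rightarrow> bool" where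
  "separable d k \<rho> \<longleftrightarrow>
     (\<exists>(N::nat) (p :: nat \<Rightarrow> real) \<sigma> \<tau>.
        (\<forall>t<N. 0 \<le> p t \<and> \<sigma> t \<in> states d \<and> \<tau> t \<in> states k) \<and>
        (\<Sum>t<N. p t) = 1 \<and>
        \<rho> = mat_sum (d * k) (d * k)
              (\<lambda>t. complex_of_real (p t) \<cdot>\<^sub>m kron (\<sigma> t) (\<tau> t)) {..<N})"

text \<open>
  For a linear map \<open>\<Phi>\<close> from \<open>d \<times> d\<close> to \<open>e \<times> e\<close> matrices, \<open>tensor_id d e k \<Phi>\<close> is the map
  \<open>\<Phi> \<otimes> I\<^sub>k\<close>. Every \<open>R\<close> is the sum over \<open>a, b < k\<close> of \<open>R\<^sub>a\<^sub>b \<otimes> E\<^sub>a\<^sub>b\<close> with matrix units \<open>E\<^sub>a\<^sub>b\<close>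
  and \<open>R\<^sub>a\<^sub>b = tensor_block d k R a b\<close>; the map applies \<open>\<Phi>\<close> to each \<open>R\<^sub>a\<^sub>b\<close>.
\<close>

definition tensor_block :: "nat \<Rightarrow> nat \<Rightarrow> complex mat \<Rightarrow> nat \<Rightarrow> nat \<Rightarrow> complex mat" where
  "tensor_block d k R a b = mat d d (\<lambda>(i, j). R $$ (i * k + a, j * k + b))"

definition tensor_id ::
  "nat \<Rightarrow> nat \<Rightarrow> nat \<Rightarrow> (complex mat \<Rightarrow> complex mat) \<Rightarrow> complex mat \<Rightarrow> complex mat" where
  "tensor_id d e k \<Phi> R = mat (e * k) (e * k)
     (\<lambda>(i, j). \<Phi> (tensor_block d k R (i mod k) (j mod k)) $$ (i div k, j div k))"

lemma tensor_id_kron: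
  assumes A: "A \<in> carrier_mat d d" and B: "B \<in> carrier_mat k k"
    and carrier: "\<Phi> A \<in> carrier_mat e e"
    and homogeneous: "\<And>c. \<Phi> (c \<cdot>\<^sub>m A) = c \<cdot>\<^sub>m \<Phi> A"
  shows "tensor_id d e k \<Phi> (kron A B) = kron (\<Phi> A) B"
proof (rule eq_matI)
  have idx: "p * k + a < d * k" if "p < d" "a < k" for p a :: nat
  proof -
    have "p * k + a < Suc p * k" using that by simp
    also have "\<dots> \<le> d * k" using that by (intro mult_le_mono1) simp
    finally show ?thesis .
  qed
  have block: "tensor_block d k (kron A B) a b = B $$ (a, b) \<cdot>\<^sub>m A" if "a < k" "b < k" for a b
    by (rule eq_matI) (use that A B idx in \<open>auto simp: tensor_block_def kron_def\<close>)
  fix i j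
  assume "i < dim_row (kron (\<Phi> A) B)" "j < dim_col (kron (\<Phi> A) B)"
  then have ij: "i < e * k" "j < e * k" using carrier B by (auto simp: kron_def)
  then have k: "0 < k" by (cases k) auto
  have "i div k < e" "j div k < e" using ij by (auto simp: less_mult_imp_div_less)
  moreover have "i mod k < k" "j mod k < k" using k by auto
  ultimately have "tensor_id d e k \<Phi> (kron A B) $$ (i, j)
      = B $$ (i mod k, j mod k) * \<Phi> A $$ (i div k, j div k)"
    using ij carrier homogeneous unfolding tensor_id_def by (simp add: block)
  then show "tensor_id d e k \<Phi> (kron A B) $$ (i, j) = kron (\<Phi> A) B $$ (i, j)"
    using ij carrier B by (auto simp: kron_def)
qed (use carrier B in \<open>auto simp: tensor_id_def kron_def\<close>)

text \<open>
  Complete positivity and trace preservation of \<open>\<Phi>\<close> are deliberately not conjuncts here, so that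
  the negation of this predicate never holds merely because \<open>\<Phi>\<close> is not a channel.
\<close>

definition entanglement_breaking ::
  "nat \<Rightarrow> nat \<Rightarrow> (complex mat \<Rightarrow> complex mat) \<Rightarrow> bool" where
  "entanglement_breaking d e \<Phi> \<longleftrightarrow>
     (\<forall>k\<ge>1. \<forall>\<rho> \<in> states (d * k). separable e k (tensor_id d e k \<Phi> \<rho>))"

text \<open>
  The space \<open>P\<^sub>k\<close> of homogeneous polynomials of degree \<open>k\<close> in two variables is represented by
  coordinates with respect to its orthonormal basis \<open>f\<^sub>0, \<dots>, f\<^sub>k\<close>, where
  \<open>f\<^sub>l = x\<^sub>1^l x\<^sub>2^(k - l) / sqrt (l! (k - l)!)\<close> is the unit vector with index \<open>l\<close> of \<open>carrier_vec (k + 1)\<close>.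

  Subtraction on \<^typ>\<open>nat\<close> is truncated. In the lower bounds of \<open>eposic_B\<close> and \<open>eposic_eps\<close> this
  supplies the maximum with 0; for \<open>h \<le> min m n\<close>, \<open>i \<le> m + n - 2 * h\<close> and \<open>j \<in> eposic_B m n h i\<close>
  no other difference below is truncated.
\<close>

definition eposic_c :: "nat \<Rightarrow> nat \<Rightarrow> nat \<Rightarrow> real" where
  "eposic_c m n h = fact (m - h) * real (m + n - 2 * h + 1)
     / (fact h * fact (n - h) * fact (m + n - h + 1))"

definition eposic_B :: "nat \<Rightarrow> nat \<Rightarrow> nat \<Rightarrow> nat \<Rightarrow> nat set" where
  "eposic_B m n h i = {i + h - m .. min (i + h) n}"

definition eposic_eps :: "nat \<Rightarrow> nat \<Rightarrow> nat \<Rightarrow> nat \<Rightarrow> nat \<Rightarrow> real" where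
  "eposic_eps m n h i j =
     (let r = m + n - 2 * h in
      \<Sum>s = max (j - i) (j + h - n) .. min h (min j (j + m - (i + h))).
        (-1) ^ s
        * sqrt (eposic_c m n h * fact r * fact m * fact n
                / (real (r choose i) * real (m choose (i + h - j)) * real (n choose j)))
        * (real (h choose s) * real ((n - h) choose (j - s)) * real ((m - h) choose (i + s - j))
           / fact (m - h)))"

definition eposic_kraus :: "nat \<Rightarrow> nat \<Rightarrow> nat \<Rightarrow> nat \<Rightarrow> complex mat" where
  "eposic_kraus m n h j = mat (m + 1) (m + n - 2 * h + 1)
     (\<lambda>(l, i). if j \<in> eposic_B m n h i \<and> l = i + h - j
                then complex_of_real (eposic_eps m n h i j) else 0)"

definition eposic_channel :: "nat \<Rightarrow> nat \<Rightarrow> nat \<Rightarrow> complex mat \<Rightarrow> complex mat" where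
  "eposic_channel m n h A = mat_sum (m + 1) (m + 1)
     (\<lambda>j. eposic_kraus m n h j * A * mat_adjoint (eposic_kraus m n h j)) {..n}"

end

theory Submission
  imports Defs "HOL-Analysis.Convex"
begin

text \<open>
  Applying an entanglement breaking channel with Kraus operators \<open>K\<^sub>j\<close> to half of a maximally
  entangled state gives a separable state \<open>\<rho> = (1/d) \<Sum>\<^sub>j w\<^sub>j w\<^sub>j\<^sup>*\<close>, where \<open>w\<^sub>j\<close> lists the
  entries of \<open>K\<^sub>j\<close>. The EPOSIC operators have pairwise disjoint supports with at most one nonzero
  entry per row and column, so the marginal of \<open>\<rho>\<close> is \<open>D/d\<close> with the diagonal matrix
  \<open>D = \<Sum>\<^sub>j K\<^sub>j K\<^sub>j\<^sup>*\<close>. Testing the reduction criterion \<open>\<rho> \<le> D/d \<otimes> I\<close> on \<open>(D\<inverse> \<otimes> I) w\<^sub>j\<close> yields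
  \<open>tr (D\<inverse> K\<^sub>j K\<^sub>j\<^sup>*) \<le> 1\<close>. These traces sum to the output dimension \<open>m + 1\<close>, which therefore does
  not exceed the number \<open>n + 1\<close> of Kraus operators.
\<close>

section \<open>Positive matrices, their 2x2 minors, and the reduction criterion for product
  states\<close>

lemma cscalar_mult_mat_vec:
  fixes A :: "complex mat"
  assumes "A \<in> carrier_mat d d" "v \<in> carrier_vec d"
  shows "(A *\<^sub>v v) \<bullet>c v = (\<Sum>x<d. \<Sum>y<d. A $$ (x, y) * v $ y * cnj (v $ x))"
  using assms by (auto simp: scalar_prod_def sum_distrib_right atLeast0LessThan intro!: sum.cong)

lemma positive_op_two_dim:
  assumes A: "positive_op d A" and i: "i < d" and j: "j < d"
  shows "0 \<le> A $$ (i, i) * a * cnj a + A $$ (i, j) * b * cnj a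
           + A $$ (j, i) * a * cnj b + A $$ (j, j) * b * cnj b"
proof -
  \<comment> \<open>The two contributions are added, so for \<open>i = j\<close> the vector has the
    single entry \<open>a + b\<close>; the degenerate case is then covered by the same
    formula.\<close>
  define e where "e x = (if x = i then a else 0) + (if x = j then b else 0)" for x
  define v where "v = vec d e"
  have e: "(\<Sum>x<d. f x * g (e x)) = (if i = j then f i * g (a + b) else f i * g a + f j * g b)"
    if "g 0 = 0" for f g :: "_ \<Rightarrow> complex"
  proof -
    have "(\<Sum>x<d. f x * g (e x)) = (\<Sum>x\<in>{i, j}. f x * g (e x))"
      using i j that by (intro sum.mono_neutral_right) (auto simp: e_def)
    then show ?thesis by (auto simp: e_def)
  qed
  have "0 \<le> (A *\<^sub>v v) \<bullet>c v"
    using A by (auto simp: positive_op_def v_def)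
  also have "(A *\<^sub>v v) \<bullet>c v = (\<Sum>x<d. \<Sum>y<d. A $$ (x, y) * v $ y * cnj (v $ x))"
    using A by (intro cscalar_mult_mat_vec) (auto simp: positive_op_def v_def)
  also have "\<dots> = (\<Sum>x<d. (\<Sum>y<d. A $$ (x, y) * e y) * cnj (e x))"
    by (simp add: v_def sum_distrib_right)
  also have "\<dots> = A $$ (i, i) * a * cnj a + A $$ (i, j) * b * cnj a
           + A $$ (j, i) * a * cnj b + A $$ (j, j) * b * cnj b"
    unfolding e[of "\<lambda>z. z", OF refl] e[of cnj, OF complex_cnj_zero]
    by (simp add: algebra_simps)
  finally show ?thesis .
qed

lemma positive_op_diag:
  assumes "positive_op d A" "i < d"
  shows "0 \<le> A $$ (i, i)"
  using positive_op_two_dim[OF assms assms(2), of 1 0] by simp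

lemma positive_op_minor:
  assumes A: "positive_op d A" and i: "i < d" and j: "j < d"
  shows "norm (A $$ (i, j)) \<le> sqrt (Re (A $$ (i, i)) * Re (A $$ (j, j)))"
proof -
  let ?z = "A $$ (i, j)" and ?p = "Re (A $$ (i, i))" and ?q = "Re (A $$ (j, j))"
  have pq: "0 \<le> ?p" "0 \<le> ?q" "Im (A $$ (i, i)) = 0" "Im (A $$ (j, j)) = 0"
    using positive_op_diag[OF A i] positive_op_diag[OF A j] by (auto simp: less_eq_complex_def)
  have "A $$ (j, i) = cnj ?z"
    \<comment> \<open>Polarization: the form at weights (1, 1) is real, which cancels the imaginary
      parts of the two off-diagonal entries; at (1, \<open>\<i>\<close>) it forces equal real
      parts.\<close>
    using positive_op_two_dim[OF A i j, of 1 1] positive_op_two_dim[OF A i j, of 1 \<i>] pq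
    by (auto simp: less_eq_complex_def complex_eq_iff)
  \<comment> \<open>The phase \<open>cnj ?z\<close> makes both cross terms real and equal, leaving a
    real quadratic in \<open>t\<close> whose sign bounds the minor.\<close>
  then have form: "0 \<le> ?p + 2 * t * (norm ?z)\<^sup>2 + t\<^sup>2 * (norm ?z)\<^sup>2 * ?q" for t :: real
    using positive_op_two_dim[OF A i j, of 1 "of_real t * cnj ?z"] pq
    unfolding cmod_power2 by (auto simp: less_eq_complex_def algebra_simps power2_eq_square)
  have "(norm ?z)\<^sup>2 \<le> ?p * ?q"
  proof (cases "?q = 0")
    case True
    have "(norm ?z)\<^sup>2 = 0"
    proof (rule ccontr)
      assume "(norm ?z)\<^sup>2 \<noteq> 0"
      then show False
        \<comment> \<open>With \<open>?q = 0\<close> the form is affine in \<open>t\<close>, and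
          this \<open>t\<close> gives it the value -1.\<close>
        using form[of "- (?p + 1) / (2 * (norm ?z)\<^sup>2)"] True by (simp add: field_simps)
    qed
    then show ?thesis using True by simp
  next
    case False
    then show ?thesis
      \<comment> \<open>This is the minimizer of the quadratic, with minimum
        \<open>?p - (norm ?z)\<^sup>2 / ?q\<close>.\<close>
      using form[of "- 1 / ?q"] pq by (simp add: field_simps power2_eq_square)
  qed
  then show ?thesis
    by (rule real_le_rsqrt)
qed

text \<open>This is the reduction criterion \<open>\<sigma> \<otimes> \<tau> \<le> \<sigma> \<otimes> I\<close>, tested on the vector with
  coordinates \<open>x (l, i)\<close> on \<open>S\<close>. As \<open>S\<close> meets each column at most once, bounding \<open>2 \<times> 2\<close>
  minors and the Cauchy-Schwarz inequality suffice; no square root of \<open>\<sigma>\<close> or \<open>\<tau>\<close> is needed.\<close>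

lemma product_state_reduction:
  assumes \<sigma>: "\<sigma> \<in> states e" and \<tau>: "\<tau> \<in> states d"
    and S: "S \<subseteq> {..<e} \<times> {..<d}" and inj: "inj_on snd S"
  shows "Re (\<Sum>u\<in>S. \<Sum>v\<in>S. cnj (x u) * (\<sigma> $$ (fst u, fst v) * \<tau> $$ (snd u, snd v)) * x v)
         \<le> (\<Sum>u\<in>S. (norm (x u))\<^sup>2 * Re (\<sigma> $$ (fst u, fst u)))"
proof -
  define s where "s u = Re (\<sigma> $$ (fst u, fst u))" for u :: "nat \<times> nat"
  define t where "t i = Re (\<tau> $$ (i, i))" for i
  have pos: "positive_op e \<sigma>" "positive_op d \<tau>"
    using \<sigma> \<tau> by (auto simp: states_def)
  have s: "0 \<le> s u" if "u \<in> S" for u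
    using positive_op_diag[OF pos(1)] S that by (auto simp: s_def less_eq_complex_def)
  have t: "0 \<le> t i" if "i < d" for i
    using positive_op_diag[OF pos(2) that] by (auto simp: t_def less_eq_complex_def)
  have t1: "(\<Sum>i<d. t i) = 1"
    using \<tau> unfolding t_def states_def by (simp flip: Re_sum)
  \<comment> \<open>The minor bounds split into one factor per index, so the double sum is dominated
    by the square of a single sum.\<close>
  define y where "y u = norm (x u) * sqrt (s u)" for u
  define z where "z u = sqrt (t (snd u))" for u :: "nat \<times> nat"
  have "Re (\<Sum>u\<in>S. \<Sum>v\<in>S. cnj (x u) * (\<sigma> $$ (fst u, fst v) * \<tau> $$ (snd u, snd v)) * x v)
        \<le> (\<Sum>u\<in>S. \<Sum>v\<in>S. (y u * z u) * (y v * z v))"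
    unfolding Re_sum
  proof (intro sum_mono)
    fix u v assume uv: "u \<in> S" "v \<in> S"
    have "Re (cnj (x u) * (\<sigma> $$ (fst u, fst v) * \<tau> $$ (snd u, snd v)) * x v)
          \<le> norm (x u) * (norm (\<sigma> $$ (fst u, fst v)) * norm (\<tau> $$ (snd u, snd v))) * norm (x v)"
      by (rule order_trans[OF complex_Re_le_cmod]) (simp add: norm_mult)
    also have "\<dots> \<le> norm (x u) * (sqrt (s u * s v) * sqrt (t (snd u) * t (snd v))) * norm (x v)"
    proof -
      have "norm (\<sigma> $$ (fst u, fst v)) \<le> sqrt (s u * s v)"
        "norm (\<tau> $$ (snd u, snd v)) \<le> sqrt (t (snd u) * t (snd v))"
        unfolding s_def t_def using S uv
        by (auto intro!: positive_op_minor[OF pos(1)] positive_op_minor[OF pos(2)])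
      moreover have "0 \<le> s u * s v" "0 \<le> t (snd u) * t (snd v)"
        using S uv s t by (auto intro!: mult_nonneg_nonneg)
      ultimately show ?thesis
        by (intro mult_mono mult_nonneg_nonneg) auto
    qed
    also have "\<dots> = (y u * z u) * (y v * z v)"
      by (simp add: y_def z_def real_sqrt_mult)
    finally show "Re (cnj (x u) * (\<sigma> $$ (fst u, fst v) * \<tau> $$ (snd u, snd v)) * x v)
        \<le> (y u * z u) * (y v * z v)" .
  qed
  also have "\<dots> = (\<Sum>u\<in>S. y u * z u)\<^sup>2"
    by (simp add: power2_eq_square sum_product)
  also have "\<dots> \<le> (\<Sum>u\<in>S. (y u)\<^sup>2) * (\<Sum>u\<in>S. (z u)\<^sup>2)"
    by (rule Cauchy_Schwarz_ineq_sum)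
  also have "\<dots> \<le> (\<Sum>u\<in>S. (y u)\<^sup>2) * 1"
  proof (intro mult_left_mono sum_nonneg)
    have "(\<Sum>u\<in>S. (z u)\<^sup>2) = (\<Sum>u\<in>S. t (snd u))"
      using S t by (intro sum.cong) (auto simp: z_def)
    \<comment> \<open>Distinct elements of \<open>S\<close> use distinct diagonal entries of
      \<open>\<tau>\<close>, so their total is at most the trace 1.\<close>
    also have "\<dots> = (\<Sum>i\<in>snd ` S. t i)"
      by (simp add: sum.reindex[OF inj])
    also have "\<dots> \<le> (\<Sum>i<d. t i)"
      using S t by (intro sum_mono2) auto
    finally show "(\<Sum>u\<in>S. (z u)\<^sup>2) \<le> 1"
      by (simp add: t1)
  qed simp
  also have "\<dots> = (\<Sum>u\<in>S. (norm (x u))\<^sup>2 * s u)"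
    using s by (simp add: y_def power_mult_distrib)
  finally show ?thesis
    by (simp add: s_def)
qed

section \<open>Pure states, the maximally entangled state, and the reduction criterion for separable
  states\<close>

lemma pure_state:
  assumes "(\<Sum>x<N. (norm (w x))\<^sup>2) = 1"
  shows "mat N N (\<lambda>(x, y). w x * cnj (w y)) \<in> states N"
proof -
  let ?A = "mat N N (\<lambda>(x, y). w x * cnj (w y))"
  have "0 \<le> (?A *\<^sub>v v) \<bullet>c v" if "v \<in> carrier_vec N" for v
  proof -
    have "(?A *\<^sub>v v) \<bullet>c v = (\<Sum>x<N. \<Sum>y<N. (w x * cnj (v $ x)) * cnj (w y * cnj (v $ y)))"
      using that by (subst cscalar_mult_mat_vec) (auto intro!: sum.cong)
    also have "\<dots> = (\<Sum>x<N. w x * cnj (v $ x)) * cnj (\<Sum>x<N. w x * cnj (v $ x))"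
      by (simp only: cnj_sum sum_product)
    also have "0 \<le> \<dots>"
      by (subst complex_mult_cnj) (simp add: less_eq_complex_def)
    finally show ?thesis .
  qed
  moreover have "(\<Sum>i<N. ?A $$ (i, i)) = 1"
    using arg_cong[OF assms, of complex_of_real]
    unfolding of_real_sum complex_norm_square by simp
  ultimately show ?thesis
    by (auto simp: states_def positive_op_def)
qed

lemma index_pair_less:
  fixes i a :: nat
  assumes "i < d" "a < k"
  shows "i * k + a < d * k"
proof -
  have "i * k + a < Suc i * k" using assms by simp
  also have "\<dots> \<le> d * k" using assms by (intro mult_le_mono1) simp
  finally show ?thesis .
qed

text \<open>This is the projector onto the sum of all e_p tensor e_p, divided by sqrt d;
  \<open>x div d = x mod d\<close> picks out the indices of these diagonal pairs.\<close>

lemma maximally_entangled_state: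
  assumes "0 < d"
  shows "mat (d * d) (d * d) (\<lambda>(x, y). if x div d = x mod d \<and> y div d = y mod d
            then 1 / of_nat d else 0) \<in> states (d * d)" (is "?R \<in> _")
proof -
  define w :: "nat \<Rightarrow> complex"
    where "w x = (if x div d = x mod d then of_real (1 / sqrt (real d)) else 0)" for x
  \<comment> \<open>Cut the index range into \<open>d\<close> blocks of length \<open>d\<close>;
    only offset \<open>p\<close> of block \<open>p\<close> contributes.\<close>
  have "(\<Sum>x<d * d. (norm (w x))\<^sup>2) = (\<Sum>p<d. \<Sum>x\<in>{p * d..<p * d + d}. (norm (w x))\<^sup>2)"
    by (rule sum.nat_group[symmetric])
  also have "\<dots> = (\<Sum>p<d. \<Sum>a<d. (norm (w (a + p * d)))\<^sup>2)"
    using sum.shift_bounds_nat_ivl[of "\<lambda>x. (norm (w x))\<^sup>2" 0 "_ * d" d]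
    by (simp add: atLeast0LessThan add.commute)
  also have "\<dots> = (\<Sum>p<d. \<Sum>a<d. if a = p then 1 / real d else 0)"
    using assms by (intro sum.cong) (auto simp: w_def norm_divide power_divide)
  also have "\<dots> = 1"
    using assms by simp
  finally have "mat (d * d) (d * d) (\<lambda>(x, y). w x * cnj (w y)) \<in> states (d * d)"
    by (rule pure_state)
  also have "mat (d * d) (d * d) (\<lambda>(x, y). w x * cnj (w y)) = ?R"
    by (rule eq_matI) (auto simp: w_def simp flip: of_real_mult)
  finally show ?thesis .
qed


text \<open>Both sides are linear in \<open>\<rho>\<close>, so the product case averages over the
  decomposition. The inner sum on the right is a diagonal entry of the marginal on the first factor;
  off-diagonal ones do not occur, as the identity on the second factor pairs \<open>u\<close> with
  \<open>v\<close> only if \<open>snd u = snd v\<close>, that is \<open>u = v\<close>.\<close>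

lemma separable_reduction:
  assumes \<rho>: "separable e d \<rho>"
    and S: "S \<subseteq> {..<e} \<times> {..<d}" and inj: "inj_on snd S"
  shows "Re (\<Sum>u\<in>S. \<Sum>v\<in>S.
           cnj (x u) * \<rho> $$ (fst u * d + snd u, fst v * d + snd v) * x v)
         \<le> (\<Sum>u\<in>S. (norm (x u))\<^sup>2 * (\<Sum>i<d. Re (\<rho> $$ (fst u * d + i, fst u * d + i))))"
proof -
  obtain N :: nat and p :: "nat \<Rightarrow> real" and \<sigma> \<tau> where
    p: "\<And>t. t < N \<Longrightarrow> 0 \<le> p t" and \<sigma>: "\<And>t. t < N \<Longrightarrow> \<sigma> t \<in> states e"
    and \<tau>: "\<And>t. t < N \<Longrightarrow> \<tau> t \<in> states d"
    and \<rho>_eq: "\<rho> = mat_sum (e * d) (e * d)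
              (\<lambda>t. complex_of_real (p t) \<cdot>\<^sub>m kron (\<sigma> t) (\<tau> t)) {..<N}"
    using \<rho> unfolding separable_def by blast
  have entry: "\<rho> $$ (l * d + i, l' * d + i')
      = (\<Sum>t<N. of_real (p t) * (\<sigma> t $$ (l, l') * \<tau> t $$ (i, i')))"
    if "l < e" "l' < e" "i < d" "i' < d" for l l' i i'
  proof -
    have "dim_row (\<sigma> t) = e" "dim_col (\<sigma> t) = e" "dim_row (\<tau> t) = d" "dim_col (\<tau> t) = d"
      if "t < N" for t
      using \<sigma>[OF that] \<tau>[OF that] by (auto simp: states_def positive_op_def)
    then show ?thesis
      using that index_pair_less[of l e i d] index_pair_less[of l' e i' d]
      by (auto simp: \<rho>_eq mat_sum_def kron_def intro!: sum.cong)
  qed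
  have marginal: "(\<Sum>i<d. Re (\<rho> $$ (l * d + i, l * d + i))) = (\<Sum>t<N. p t * Re (\<sigma> t $$ (l, l)))"
    if "l < e" for l
  proof -
    have "(\<Sum>i<d. \<rho> $$ (l * d + i, l * d + i))
        = (\<Sum>i<d. \<Sum>t<N. of_real (p t) * (\<sigma> t $$ (l, l) * \<tau> t $$ (i, i)))"
      using that by (intro sum.cong) (auto simp: entry)
    also have "\<dots> = (\<Sum>t<N. \<Sum>i<d. of_real (p t) * (\<sigma> t $$ (l, l) * \<tau> t $$ (i, i)))"
      by (rule sum.swap)
    also have "\<dots> = (\<Sum>t<N. of_real (p t) * (\<sigma> t $$ (l, l) * (\<Sum>i<d. \<tau> t $$ (i, i))))"
      by (simp add: sum_distrib_left)
    also have "\<dots> = (\<Sum>t<N. of_real (p t) * \<sigma> t $$ (l, l))"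
      using \<tau> by (intro sum.cong) (auto simp: states_def)
    finally have "Re (\<Sum>i<d. \<rho> $$ (l * d + i, l * d + i)) = Re (\<Sum>t<N. of_real (p t) * \<sigma> t $$ (l, l))"
      by (rule arg_cong)
    then show ?thesis
      by simp
  qed
  have S': "fst u < e" "snd u < d" if "u \<in> S" for u
    using S that by auto
  have "(\<Sum>u\<in>S. \<Sum>v\<in>S. cnj (x u) * \<rho> $$ (fst u * d + snd u, fst v * d + snd v) * x v)
      = (\<Sum>u\<in>S. \<Sum>v\<in>S. \<Sum>t<N. of_real (p t) *
          (cnj (x u) * (\<sigma> t $$ (fst u, fst v) * \<tau> t $$ (snd u, snd v)) * x v))"
    by (intro sum.cong refl, simp only: entry S')
      (simp add: sum_distrib_left sum_distrib_right mult_ac)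
  also have "\<dots> = (\<Sum>u\<in>S. \<Sum>t<N. \<Sum>v\<in>S. of_real (p t) *
          (cnj (x u) * (\<sigma> t $$ (fst u, fst v) * \<tau> t $$ (snd u, snd v)) * x v))"
    by (intro sum.cong refl sum.swap)
  also have "\<dots> = (\<Sum>t<N. \<Sum>u\<in>S. \<Sum>v\<in>S. of_real (p t) *
          (cnj (x u) * (\<sigma> t $$ (fst u, fst v) * \<tau> t $$ (snd u, snd v)) * x v))"
    by (rule sum.swap)
  also have "\<dots> = (\<Sum>t<N. of_real (p t) * (\<Sum>u\<in>S. \<Sum>v\<in>S.
          cnj (x u) * (\<sigma> t $$ (fst u, fst v) * \<tau> t $$ (snd u, snd v)) * x v))"
    by (simp only: sum_distrib_left)
  finally have "Re (\<Sum>u\<in>S. \<Sum>v\<in>S. cnj (x u) * \<rho> $$ (fst u * d + snd u, fst v * d + snd v) * x v)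
      = (\<Sum>t<N. p t * Re (\<Sum>u\<in>S. \<Sum>v\<in>S.
          cnj (x u) * (\<sigma> t $$ (fst u, fst v) * \<tau> t $$ (snd u, snd v)) * x v))"
    by (simp only: Re_sum Re_complex_of_real Im_complex_of_real times_complex.sel mult_zero_left diff_zero)
  also have "\<dots> \<le> (\<Sum>t<N. p t * (\<Sum>u\<in>S. (norm (x u))\<^sup>2 * Re (\<sigma> t $$ (fst u, fst u))))"
    by (intro sum_mono mult_left_mono product_state_reduction[OF \<sigma> \<tau> S inj]) (auto simp: p)
  also have "\<dots> = (\<Sum>t<N. \<Sum>u\<in>S. (norm (x u))\<^sup>2 * (p t * Re (\<sigma> t $$ (fst u, fst u))))"
    by (simp add: sum_distrib_left mult_ac)
  also have "\<dots> = (\<Sum>u\<in>S. (norm (x u))\<^sup>2 * (\<Sum>t<N. p t * Re (\<sigma> t $$ (fst u, fst u))))"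
    by (subst sum.swap) (simp add: sum_distrib_left)
  also have "\<dots> = (\<Sum>u\<in>S. (norm (x u))\<^sup>2 * (\<Sum>i<d. Re (\<rho> $$ (fst u * d + i, fst u * d + i))))"
    by (intro sum.cong) (auto simp: marginal S')
  finally show ?thesis .
qed

section \<open>Kraus operators applied to half of a maximally entangled state\<close>

lemma index_mat_adjoint:
  fixes K :: "complex mat"
  assumes "i < dim_col K" "j < dim_row K"
  shows "mat_adjoint K $$ (i, j) = cnj (K $$ (j, i))"
  using assms by (simp add: mat_adjoint_def mat_of_rows_def)

lemma mat_adjoint_carrier:
  fixes K :: "complex mat"
  assumes "K \<in> carrier_mat e d"
  shows "mat_adjoint K \<in> carrier_mat d e"
  using assms by (auto simp: mat_adjoint_def)

text \<open>The blocks of the maximally entangled state are scaled matrix units, so this formula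
  yields every entry of the output state.\<close>

lemma kraus_matrix_unit:
  fixes K :: "complex mat"
  assumes K: "K \<in> carrier_mat e d" and "l < e" "l' < e" "a < d" "b < d"
  shows "(K * mat d d (\<lambda>(p, q). if p = a \<and> q = b then c else 0) * mat_adjoint K) $$ (l, l')
         = c * K $$ (l, a) * cnj (K $$ (l', b))" (is "(K * ?E * _) $$ _ = _")
proof -
  have KE: "(K * ?E) $$ (l, q) = (if q = b then K $$ (l, a) * c else 0)" if "q < d" for q
  proof -
    have "(K * ?E) $$ (l, q) = (\<Sum>p<d. K $$ (l, p) * ?E $$ (p, q))"
      using that assms by (simp add: scalar_prod_def atLeast0LessThan)
    also have "\<dots> = (\<Sum>p<d. if p = a then if q = b then K $$ (l, a) * c else 0 else 0)"
      using that by (intro sum.cong) auto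
    finally show ?thesis
      using assms by simp
  qed
  have "(K * ?E * mat_adjoint K) $$ (l, l') = (\<Sum>q<d. (K * ?E) $$ (l, q) * mat_adjoint K $$ (q, l'))"
    using assms mat_adjoint_carrier[OF K] by (simp add: scalar_prod_def atLeast0LessThan)
  also have "\<dots> = (\<Sum>q<d. if q = b then K $$ (l, a) * c * cnj (K $$ (l', b)) else 0)"
    using assms by (intro sum.cong) (auto simp: KE index_mat_adjoint simp del: index_mult_mat)
  finally show ?thesis
    using assms by simp
qed


text \<open>The support hypotheses have separate tasks: \<open>disjoint\<close> removes the other
  Kraus operators from the tested entries, \<open>column\<close> makes \<open>snd\<close> injective
  on each support, and \<open>row\<close> makes every \<open>D l\<close> positive, so that it can be
  inverted.\<close>

lemma entanglement_breaking_kraus_card: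
  fixes K :: "'i \<Rightarrow> complex mat"
  assumes J: "finite J" and K: "\<And>j. j \<in> J \<Longrightarrow> K j \<in> carrier_mat e d"
    and disjoint: "\<And>j j' l i. \<lbrakk>j \<in> J; j' \<in> J; l < e; i < d; K j $$ (l, i) \<noteq> 0; K j' $$ (l, i) \<noteq> 0\<rbrakk>
                     \<Longrightarrow> j = j'"
    and column: "\<And>j l l' i. \<lbrakk>j \<in> J; l < e; l' < e; i < d; K j $$ (l, i) \<noteq> 0; K j $$ (l', i) \<noteq> 0\<rbrakk>
                     \<Longrightarrow> l = l'"
    and row: "\<And>l. l < e \<Longrightarrow> \<exists>j\<in>J. \<exists>i<d. K j $$ (l, i) \<noteq> 0"
    and d: "0 < d"
    and EB: "entanglement_breaking d e (\<lambda>A. mat_sum e e (\<lambda>j. K j * A * mat_adjoint (K j)) J)"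
  shows "e \<le> card J"
proof -
  define \<Phi> where "\<Phi> A = mat_sum e e (\<lambda>j. K j * A * mat_adjoint (K j)) J" for A
  define R :: "complex mat" where "R = mat (d * d) (d * d)
    (\<lambda>(x, y). if x div d = x mod d \<and> y div d = y mod d then 1 / of_nat d else 0)"
  define \<rho> where "\<rho> = tensor_id d e d \<Phi> R"
  have sep: "separable e d \<rho>"
    using EB maximally_entangled_state[OF d] d
    unfolding entanglement_breaking_def \<rho>_def R_def \<Phi>_def by (simp add: Suc_le_eq)
  have block: "tensor_block d d R i i' = mat d d (\<lambda>(p, q). if p = i \<and> q = i' then 1 / of_nat d else 0)"
    if "i < d" "i' < d" for i i'
    using that index_pair_less[of _ d _ d] unfolding tensor_block_def R_def
    by (intro eq_matI) auto
  have entry: "\<rho> $$ (l * d + i, l' * d + i') = (\<Sum>j\<in>J. 1 / of_nat d * K j $$ (l, i) * cnj (K j $$ (l', i')))"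
    if "l < e" "l' < e" "i < d" "i' < d" for l l' i i'
  proof -
    have "\<rho> $$ (l * d + i, l' * d + i') = \<Phi> (tensor_block d d R i i') $$ (l, l')"
      using that index_pair_less[of l e i d] index_pair_less[of l' e i' d]
      by (simp add: \<rho>_def tensor_id_def)
    then show ?thesis
      using that by (simp add: \<Phi>_def mat_sum_def block kraus_matrix_unit[OF K])
  qed
  define D where "D l = (\<Sum>j\<in>J. \<Sum>i<d. (norm (K j $$ (l, i)))\<^sup>2)" for l
  have D: "0 < D l" if l: "l < e" for l
  proof -
    obtain j i where ji: "j \<in> J" "i < d" "K j $$ (l, i) \<noteq> 0"
      using row[OF l] by blast
    then have "0 < (\<Sum>i<d. (norm (K j $$ (l, i)))\<^sup>2)"
      by (intro sum_pos2[of _ i]) auto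
    with ji J show ?thesis
      unfolding D_def by (intro sum_pos2[of _ j]) (auto intro: sum_nonneg)
  qed
  have marginal: "(\<Sum>i<d. Re (\<rho> $$ (l * d + i, l * d + i))) = D l / d" if "l < e" for l
  proof -
    have "(\<Sum>i<d. Re (\<rho> $$ (l * d + i, l * d + i))) = (\<Sum>i<d. \<Sum>j\<in>J. (norm (K j $$ (l, i)))\<^sup>2 / d)"
    proof (intro sum.cong refl)
      fix i assume "i \<in> {..<d}"
      then have "\<rho> $$ (l * d + i, l * d + i) = (\<Sum>j\<in>J. of_real ((norm (K j $$ (l, i)))\<^sup>2 / d))"
        unfolding of_real_divide complex_norm_square using that by (simp add: entry)
      then show "Re (\<rho> $$ (l * d + i, l * d + i)) = (\<Sum>j\<in>J. (norm (K j $$ (l, i)))\<^sup>2 / d)"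
        by (simp only: Re_sum Re_complex_of_real)
    qed
    then show ?thesis
      unfolding D_def by (subst (asm) sum.swap) (simp add: sum_divide_distrib)
  qed
  define S where "S j = {u \<in> {..<e} \<times> {..<d}. K j $$ u \<noteq> 0}" for j
  define W where "W j = (\<Sum>u\<in>S j. (norm (K j $$ u))\<^sup>2 / D (fst u))" for j
  have "W j \<le> 1" if j: "j \<in> J" for j
  proof -
    \<comment> \<open>Weighting by 1/D expresses both sides of the reduction inequality through
      \<open>W j\<close>: the left becomes \<open>(W j)\<^sup>2 / d\<close>, the right
      \<open>W j / d\<close>.\<close>
    define x where "x u = K j $$ u / of_real (D (fst u))" for u
    have sub: "S j \<subseteq> {..<e} \<times> {..<d}"
      by (auto simp: S_def)
    have inj: "inj_on snd (S j)"
      using column[OF j] by (fastforce simp: S_def inj_on_def)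
    have summand: "cnj (x u) * \<rho> $$ (fst u * d + snd u, fst v * d + snd v) * x v
        = of_real (((norm (K j $$ u))\<^sup>2 / D (fst u)) * ((norm (K j $$ v))\<^sup>2 / D (fst v)) / d)"
      if uv: "u \<in> S j" "v \<in> S j" for u v
    proof -
      have "\<rho> $$ (fst u * d + snd u, fst v * d + snd v)
          = (\<Sum>j'\<in>J. 1 / of_nat d * K j' $$ u * cnj (K j' $$ v))"
        using uv by (auto simp: S_def entry)
      also have "\<dots> = (\<Sum>j'\<in>{j}. 1 / of_nat d * K j' $$ u * cnj (K j' $$ v))"
        using J j uv disjoint[OF j] by (intro sum.mono_neutral_right) (force simp: S_def)+
      finally show ?thesis
        unfolding x_def of_real_mult of_real_divide complex_norm_square by (simp add: mult_ac)
    qed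
    have "Re (\<Sum>u\<in>S j. \<Sum>v\<in>S j. cnj (x u) * \<rho> $$ (fst u * d + snd u, fst v * d + snd v) * x v)
        = (\<Sum>u\<in>S j. \<Sum>v\<in>S j. ((norm (K j $$ u))\<^sup>2 / D (fst u)) * ((norm (K j $$ v))\<^sup>2 / D (fst v)) / d)"
      by (simp only: summand Re_sum Re_complex_of_real cong: sum.cong)
    also have "\<dots> = (W j)\<^sup>2 / d"
      by (simp add: W_def power2_eq_square sum_product sum_divide_distrib)
    finally have "(W j)\<^sup>2 / d \<le> (\<Sum>u\<in>S j. (norm (x u))\<^sup>2 * (\<Sum>i<d. Re (\<rho> $$ (fst u * d + i, fst u * d + i))))"
      using separable_reduction[OF sep sub inj, of x] by simp
    also have "\<dots> = (\<Sum>u\<in>S j. (norm (K j $$ u))\<^sup>2 / D (fst u) / d)"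
    proof (intro sum.cong refl)
      fix u assume u: "u \<in> S j"
      then have "fst u < e" by (auto simp: S_def)
      then show "(norm (x u))\<^sup>2 * (\<Sum>i<d. Re (\<rho> $$ (fst u * d + i, fst u * d + i)))
          = (norm (K j $$ u))\<^sup>2 / D (fst u) / d"
        using D[of "fst u"] unfolding marginal[OF \<open>fst u < e\<close>]
        by (simp add: x_def norm_divide power2_eq_square field_simps)
    qed
    also have "\<dots> = W j / d"
      by (simp add: W_def sum_divide_distrib)
    finally have "(W j)\<^sup>2 \<le> W j"
      using d by (simp add: divide_le_cancel)
    then show ?thesis
      by (cases "W j \<le> 0") (auto simp: power2_eq_square)
  qed
  then have "(\<Sum>j\<in>J. W j) \<le> (\<Sum>j\<in>J. 1)"
    by (rule sum_mono)
  moreover have "(\<Sum>j\<in>J. W j) = e"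
  proof -
    have "(\<Sum>j\<in>J. W j) = (\<Sum>j\<in>J. \<Sum>u\<in>{..<e} \<times> {..<d}. (norm (K j $$ u))\<^sup>2 / D (fst u))"
      unfolding W_def S_def by (intro sum.cong refl sum.mono_neutral_left) auto
    also have "\<dots> = (\<Sum>j\<in>J. \<Sum>l<e. \<Sum>i<d. (norm (K j $$ (l, i)))\<^sup>2 / D l)"
      by (simp add: sum.cartesian_product split_def)
    \<comment> \<open>Collected by rows, the squared entries of row \<open>l\<close> over all
      operators add up to \<open>D l\<close>, so each row contributes 1.\<close>
    also have "\<dots> = (\<Sum>l<e. \<Sum>j\<in>J. \<Sum>i<d. (norm (K j $$ (l, i)))\<^sup>2 / D l)"
      by (rule sum.swap)
    also have "\<dots> = (\<Sum>l<e. D l / D l)"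
      by (simp only: sum_divide_distrib[symmetric] D_def[symmetric])
    also have "\<dots> = (\<Sum>l<e. 1)"
      using D by (intro sum.cong) (auto simp: less_imp_neq[THEN not_sym])
    finally show ?thesis by simp
  qed
  ultimately show ?thesis
    by simp
qed

section \<open>Supports and nonvanishing entries of the EPOSIC Kraus operators\<close>

lemma index_eposic_kraus:
  assumes "l < m + 1" "i < m + n - 2 * h + 1"
  shows "eposic_kraus m n h j $$ (l, i)
         = (if j \<in> eposic_B m n h i \<and> l = i + h - j then of_real (eposic_eps m n h i j) else 0)"
  using assms by (simp add: eposic_kraus_def)

text \<open>Membership in \<open>eposic_B\<close> gives \<open>j \<le> i + h\<close>, so the
  truncated difference is exact. The resulting line determines \<open>j\<close> from the entry, and
  \<open>l\<close> from \<open>j\<close> and the column, which gives both support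
  hypotheses.\<close>

lemma eposic_kraus_support:
  assumes "l < m + 1" "i < m + n - 2 * h + 1" "eposic_kraus m n h j $$ (l, i) \<noteq> 0"
  shows "l + j = i + h"
  using assms by (auto simp: index_eposic_kraus eposic_B_def split: if_splits)

lemma eposic_c_pos: "0 < eposic_c m n h"
  by (simp add: eposic_c_def)

text \<open>For \<open>j = 0\<close>, and for \<open>i = 0\<close>, only one index \<open>s\<close> contributes to \<open>\<epsilon>\<^sub>i\<^sup>j\<close>.\<close>

lemma eposic_eps_0_right:
  assumes "h \<le> n" "i + h \<le> m"
  shows "eposic_eps m n h i 0 \<noteq> 0"
proof -
  \<comment> \<open>Keeps the binomial \<open>r choose i\<close> under the root nonzero.\<close>
  have "i \<le> m + n - 2 * h"
    using assms by simp
  moreover have "{h - n..0} = {0::nat}"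
    using assms by auto
  ultimately show ?thesis
    using assms eposic_c_pos[of m n h]
    by (simp add: eposic_eps_def Let_def)
qed

lemma eposic_eps_0_left:
  assumes "h \<le> min m n" "j \<le> h"
  shows "eposic_eps m n h 0 j \<noteq> 0"
proof -
  \<comment> \<open>The bounds meet at \<open>s = j\<close> because \<open>h \<le> n\<close> and
    \<open>j \<le> h \<le> m\<close>.\<close>
  have single: "{max (j - 0) (j + h - n)..min h (min j (j + m - (0 + h)))} = {j}"
    using assms by auto
  show ?thesis
    using assms eposic_c_pos[of m n h]
    unfolding eposic_eps_def Let_def single by auto
qed

text \<open>Row \<open>l\<close> is met where the line \<open>l + j = i + h\<close> reaches
  \<open>j = 0\<close> (if \<open>h \<le> l\<close>) or \<open>i = 0\<close> (otherwise). At these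
  ends the alternating sum has one term, so no cancellation can occur.\<close>

lemma eposic_kraus_row:
  assumes h: "h \<le> min m n" and l: "l < m + 1"
  shows "\<exists>j\<in>{..n}. \<exists>i<m + n - 2 * h + 1. eposic_kraus m n h j $$ (l, i) \<noteq> 0"
proof (cases "h \<le> l")
  case True
  then have "eposic_kraus m n h 0 $$ (l, l - h) \<noteq> 0"
    using h l eposic_eps_0_right[of h n "l - h" m]
    by (auto simp: index_eposic_kraus eposic_B_def)
  moreover have "l - h < m + n - 2 * h + 1"
    using h l by auto
  ultimately show ?thesis by blast
next
  case False
  then have "eposic_kraus m n h (h - l) $$ (l, 0) \<noteq> 0"
    using h l eposic_eps_0_left[of h m n "h - l"]
    by (auto simp: index_eposic_kraus eposic_B_def)
  moreover have "h - l \<in> {..n}"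
    using h by auto
  ultimately show ?thesis by (intro bexI exI[of _ 0]) auto
qed

lemma eposic_channel_not_entanglement_breaking:
  assumes "h \<le> min m n" "n < m"
  shows "\<not> entanglement_breaking (m + n - 2 * h + 1) (m + 1) (eposic_channel m n h)"
proof
  assume "entanglement_breaking (m + n - 2 * h + 1) (m + 1) (eposic_channel m n h)"
  then have "entanglement_breaking (m + n - 2 * h + 1) (m + 1)
    (\<lambda>A. mat_sum (m + 1) (m + 1)
       (\<lambda>j. eposic_kraus m n h j * A * mat_adjoint (eposic_kraus m n h j)) {..n})"
    unfolding eposic_channel_def[abs_def] .
  then have "m + 1 \<le> card {..n}"
  proof (rule entanglement_breaking_kraus_card[rotated -1])
    show "eposic_kraus m n h j \<in> carrier_mat (m + 1) (m + n - 2 * h + 1)" for j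
      by (simp add: eposic_kraus_def)
    show "j = j'" if "l < m + 1" "i < m + n - 2 * h + 1"
      "eposic_kraus m n h j $$ (l, i) \<noteq> 0" "eposic_kraus m n h j' $$ (l, i) \<noteq> 0" for j j' l i
      using eposic_kraus_support[OF that(1,2,3)] eposic_kraus_support[OF that(1,2,4)] by simp
    show "l = l'" if "l < m + 1" "l' < m + 1" "i < m + n - 2 * h + 1"
      "eposic_kraus m n h j $$ (l, i) \<noteq> 0" "eposic_kraus m n h j $$ (l', i) \<noteq> 0" for j l l' i
      using eposic_kraus_support[OF that(1,3,4)] eposic_kraus_support[OF that(2,3,5)] by simp
  qed (use assms eposic_kraus_row in auto)
  then show False
    using assms by simp
qed

theorem corollary3p11:
  shows "(\<forall>m n h :: nat. h \<le> min m n \<and> m > n \<longrightarrow>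
            \<not> entanglement_breaking (m + n - 2 * h + 1) (m + 1) (eposic_channel m n h))
       \<and> (\<forall>m h :: nat. h < m \<longrightarrow>
            \<not> entanglement_breaking (m + h - 2 * h + 1) (m + 1) (eposic_channel m h h))"
  by (intro conjI allI impI eposic_channel_not_entanglement_breaking) auto

end
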